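(* Let $k \ge 1$ be an integer and let $F$ be a satisfiable propositional CNF formula with $n$ variables, where $n > 2^k$. Let $R_F \subseteq \{0,1\}^n$ be the set of satisfying assignments (witnesses) of $F$, and assume that $\log_2 |R_F| - \frac{1}{k}\log_2 n$ is an integer. Then algorithm $\mathsf{UniWit}$ on inputs $F$ and $k$ succeeds (i.e. does not return $\bot$) with probability at least $\frac{1}{8}$.
   Context: **Hash families.** For integers $n, m, r$ let $H(n,m,r)$ denote a family of $r$-wise independent hash functions from $\{0,1\}^n$ to $\{0,1\}^m$: if $h$ is chosen uniformly at random from $H(n,m,r)$, then for all $\alpha_1,\dots,\alpha_r \in \{0,1\}^m$ and all distinct $y_1,\dots,y_r \in \{0,1\}^n$, $\Pr\left[\bigwedge_{i=1}^r h(y_i)=\alpha_i\right] = 2^{-mr}$. For $m=0$, $\{0,1\}^0$ is a one-point set and $h$ is the constant map. A number $r$ with $2 \le r \le 2^n$ and the families $H(n,m,r)$ ($0 \le m \le n$) are fixed in advance. **BoundedSAT.** $\mathsf{BoundedSAT}(G, t)$ takes a propositional formula $G$ (a conjunction of a CNF formula and xor constraints, or more generally any constraint on the variables) and an integer $t \ge 0$, and returns a set $S$ of witnesses of $G$ with $|S| = \min(t, \#G)$, where $\#G$ is the number of all witnesses of $G$. **Algorithm $\mathsf{UniWit}(F,k)$.** Input: a CNF formula $F$ with variables $z_1,\dots,z_n$ and an integer $k \ge 1$. Output: a witness of $F$ or the failure symbol $\bot$. All random choices are uniform over the indicated sets and mutually independent. 1. $\mathrm{pivot} \leftarrow \lceil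 2n^{1/k} \rceil$; $S \leftarrow \mathsf{BoundedSAT}(F, \mathrm{pivot}+1)$. 2. If $|S| \le \mathrm{pivot}$: let $y_1,\dots,y_{|S|}$ be the elements of $S$; choose $j$ at random from $\{1,\dots,|S|\}$ and return $y_j$. 3. Otherwise: set $l \leftarrow \lfloor \frac{1}{k}\log_2 n \rfloor$ and $i \leftarrow l-1$, and repeat the following: - $i \leftarrow i+1$; - choose $h$ at random from $H(n, i-l, r)$; - choose $\alpha$ at random from $\{0,1\}^{i-l}$; - $S \leftarrow \mathsf{BoundedSAT}\big(F \wedge (h(z_1,\dots,z_n)=\alpha),\ \mathrm{pivot}+1\big)$; until ($1 \le |S| \le \mathrm{pivot}$) or ($i = n$). 4. After the loop: if $|S| > \mathrm{pivot}$ or $|S| < 1$, return $\bot$. Otherwise let $y_1,\dots,y_{|S|}$ be the elements of $S$ and choose $j$ at random from $\{1,\dots,\mathrm{pivot}\}$; if $j \le |S|$ return $y_j$, else return $\bot$. *)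

theory Defs
  imports "HOL-Probability.Probability"
begin

text \<open>The set \<open>{0,1}\<^sup>n\<close>; an assignment \<open>x\<close> gives the variable with index \<open>v < n\<close> the value \<open>x ! v\<close>.\<close>

definition bits :: "nat \<Rightarrow> bool list set" where
  "bits n = {x. length x = n}"

datatype literal = Pos nat | Neg nat

fun var :: "literal \<Rightarrow> nat" where
  "var (Pos v) = v"
| "var (Neg v) = v"

type_synonym cnf = "literal list list"

definition cnf_vars :: "cnf \<Rightarrow> nat set" where
  "cnf_vars F = (\<Union>C\<in>set F. var ` set C)"

fun lit_true :: "bool list \<Rightarrow> literal \<Rightarrow> bool" where
  "lit_true x (Pos v) \<longleftrightarrow> x ! v"
| "lit_true x (Neg v) \<longleftrightarrow> \<not> x ! v"

definition cnf_true :: "bool list \<Rightarrow> cnf \<Rightarrow> bool" where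
  "cnf_true x F \<longleftrightarrow> (\<forall>C\<in>set F. \<exists>L\<in>set C. lit_true x L)"

text \<open>Xor constraints, and the hash constraints \<open>h(z) = \<alpha>\<close>, are instances of \<open>Constraint\<close>.\<close>

datatype formula = CNF cnf | Constraint "bool list \<Rightarrow> bool" | Conj formula formula

fun formula_true :: "bool list \<Rightarrow> formula \<Rightarrow> bool" where
  "formula_true x (CNF F) \<longleftrightarrow> cnf_true x F"
| "formula_true x (Constraint P) \<longleftrightarrow> P x"
| "formula_true x (Conj G G') \<longleftrightarrow> formula_true x G \<and> formula_true x G'"

definition witnesses :: "nat \<Rightarrow> formula \<Rightarrow> bool list set" where
  "witnesses n G = {x \<in> bits n. formula_true x G}"

text \<open>Which witnesses are returned is left unspecified.\<close>

definition is_BoundedSAT :: "nat \<Rightarrow> (formula \<Rightarrow> nat \<Rightarrow> bool list set) \<Rightarrow> bool" where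
  "is_BoundedSAT n bsat \<longleftrightarrow>
     (\<forall>G t. bsat G t \<subseteq> witnesses n G \<and> card (bsat G t) = min t (card (witnesses n G)))"

text \<open>Hash functions are constrained on \<open>bits n\<close> only; their values elsewhere are irrelevant.\<close>

definition r_wise_independent ::
    "nat \<Rightarrow> nat \<Rightarrow> nat \<Rightarrow> (bool list \<Rightarrow> bool list) set \<Rightarrow> bool" where
  "r_wise_independent n m r Hs \<longleftrightarrow>
     finite Hs \<and> Hs \<noteq> {} \<and> Hs \<subseteq> (bits n \<rightarrow> bits m) \<and>
     (\<forall>as ys. length as = r \<and> set as \<subseteq> bits m \<and>
              length ys = r \<and> set ys \<subseteq> bits n \<and> distinct ys \<longrightarrow>
        measure_pmf.prob (pmf_of_set Hs) {h. \<forall>i<r. h (ys ! i) = as ! i} = 1 / 2 ^ (m * r))"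

definition list_of :: "'a set \<Rightarrow> 'a list" where
  "list_of S = (SOME ys. set ys = S \<and> distinct ys)"

definition pivot :: "nat \<Rightarrow> nat \<Rightarrow> nat" where
  "pivot n k = nat \<lceil>2 * real n powr (1 / real k)\<rceil>"

definition start_index :: "nat \<Rightarrow> nat \<Rightarrow> nat" where
  "start_index n k = nat \<lfloor>1 / real k * log 2 (real n)\<rfloor>"

text \<open>
  The iteration of the loop with index \<open>i\<close> and all following ones, returning the final set \<open>S\<close>.
  The loop is entered with \<open>i = l \<le> n\<close> and \<open>i\<close> grows in steps of one, so \<open>i \<ge> n\<close> is the
  exit condition \<open>i = n\<close>; the inequality makes the recursion terminate for all arguments.
\<close>

function UniWit_loop ::
    "(nat \<Rightarrow> nat \<Rightarrow> nat \<Rightarrow> (bool list \<Rightarrow> bool list) set) \<Rightarrow> (formula \<Rightarrow> nat \<Rightarrow> bool list set) \<Rightarrow>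
     nat \<Rightarrow> nat \<Rightarrow> cnf \<Rightarrow> nat \<Rightarrow> nat \<Rightarrow> nat \<Rightarrow> bool list set pmf" where
  "UniWit_loop H bsat r n F piv l i =
     do {
       h \<leftarrow> pmf_of_set (H n (i - l) r);
       a \<leftarrow> pmf_of_set (bits (i - l));
       let S = bsat (Conj (CNF F) (Constraint (\<lambda>z. h z = a))) (piv + 1);
       if (1 \<le> card S \<and> card S \<le> piv) \<or> i \<ge> n
       then return_pmf S
       else UniWit_loop H bsat r n F piv l (i + 1)
     }"
  by pat_completeness auto
termination
  by (relation "Wellfounded.measure (\<lambda>(H, bsat, r, n, F, piv, l, i). n - i)") auto

declare UniWit_loop.simps [simp del]

text \<open>\<open>None\<close> is the failure symbol. For unsatisfiable \<open>F\<close> the choice of \<open>j\<close> from the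
  empty set \<open>{1..0}\<close> has no meaning.\<close>

definition UniWit ::
    "(nat \<Rightarrow> nat \<Rightarrow> nat \<Rightarrow> (bool list \<Rightarrow> bool list) set) \<Rightarrow> (formula \<Rightarrow> nat \<Rightarrow> bool list set) \<Rightarrow>
     nat \<Rightarrow> nat \<Rightarrow> cnf \<Rightarrow> nat \<Rightarrow> bool list option pmf" where
  "UniWit H bsat r n F k =
     (let piv = pivot n k; S = bsat (CNF F) (piv + 1) in
      if card S \<le> piv then
        do {
          j \<leftarrow> pmf_of_set {1..card S};
          return_pmf (Some (list_of S ! (j - 1)))
        }
      else
        do {
          let l = start_index n k;
          S \<leftarrow> UniWit_loop H bsat r n F piv l l;
          if card S > piv \<or> card S < 1 then return_pmf None
          else do {
            j \<leftarrow> pmf_of_set {1..piv};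
            return_pmf (if j \<le> card S then Some (list_of S ! (j - 1)) else None)
          }
        })"

end

theory Submission
  imports Defs
begin

text \<open>
  Let \<open>q = n\<^bsup>1/k\<^esup>\<close>, so that there are \<open>2\<^sup>d q\<close> witnesses for some natural number \<open>d\<close>, and a
  hash cell of the iteration \<open>l + m\<close> has expected size \<open>\<mu> = 2\<^sup>d\<^sup>-\<^sup>m q\<close> and variance at most \<open>\<mu>\<close>.
  In iteration \<open>l + d\<close> the success probability is at least \<open>x - x\<^sup>2 \<ge> 6/25\<close>, where
  \<open>x = q / pivot \<in> [2/5, 1/2]\<close>. An earlier iteration can only do harm by stopping with so small a cell
  that the final choice of \<open>j\<close> mostly fails. For \<open>pivot \<le> 8\<close> no cell is that small. Otherwise
  \<open>q \<ge> 4\<close>, and by Chebyshev's inequality the iteration \<open>l + m\<close> yields a cell of size below \<open>27/50 q\<close>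
  with probability at most \<open>47/100 \<cdot> 2\<^sup>m\<^sup>-\<^sup>d\<close>, so that all these losses together leave a factor of at least
  \<open>53/100\<close>.
\<close>

section \<open>Probabilities of sequential random choices, and the cube
  \<open>bits m\<close>\<close>

lemma prob_bind_pmf:
  "measure_pmf.prob (bind_pmf p f) A = measure_pmf.expectation p (\<lambda>x. measure_pmf.prob (f x) A)"
proof -
  have "ennreal (measure_pmf.prob (bind_pmf p f) A) = (\<integral>\<^sup>+x. ennreal (measure_pmf.prob (f x) A) \<partial>p)"
    by (simp flip: measure_pmf.emeasure_eq_measure)
  also have "\<dots> = ennreal (measure_pmf.expectation p (\<lambda>x. measure_pmf.prob (f x) A))"
    by (intro nn_integral_eq_integral measure_pmf.integrable_const_bound[where B = 1]) auto
  finally show ?thesis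
    by (simp add: integral_nonneg_AE)
qed

lemma prob_bind_pmf_ge:
  assumes "\<And>x. x \<in> set_pmf p \<Longrightarrow> c \<le> measure_pmf.prob (f x) A"
  shows "c \<le> measure_pmf.prob (bind_pmf p f) A"
  unfolding prob_bind_pmf
  by (intro measure_pmf.integral_ge_const measure_pmf.integrable_const_bound[where B = 1])
     (auto intro!: AE_pmfI assms)

lemma finite_bits [simp]: "finite (bits m)"
  using finite_lists_length_eq[of "UNIV :: bool set" m] by (simp add: bits_def)

lemma card_bits [simp]: "card (bits m) = 2 ^ m"
  using card_lists_length_eq[of "UNIV :: bool set" m] by (simp add: bits_def)

lemma bits_nonempty [simp]: "bits m \<noteq> {}"
  by (auto simp: bits_def intro: exI[of _ "replicate m False"])

section \<open>Limited independence and the moments of a cell size\<close>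

text \<open>Marginalisation: since \<open>Suc r \<le> 2 ^ n\<close>, there is a further point
  \<open>y\<close>, and summing over the \<open>2 ^ m\<close> possible values of \<open>h y\<close>
  cancels one factor \<open>1 / 2 ^ m\<close>.\<close>

lemma r_wise_independent_Suc:
  assumes "r_wise_independent n m (Suc r) Hs" and "Suc r \<le> 2 ^ n"
  shows "r_wise_independent n m r Hs"
  unfolding r_wise_independent_def
proof (intro conjI allI impI)
  have fin: "finite Hs" and ne: "Hs \<noteq> {}" and sub: "Hs \<subseteq> (bits n \<rightarrow> bits m)"
    using assms(1) by (auto simp: r_wise_independent_def)
  show "finite Hs" "Hs \<noteq> {}" "Hs \<subseteq> (bits n \<rightarrow> bits m)"
    by fact+
  fix as ys :: "bool list list"
  assume *: "length as = r \<and> set as \<subseteq> bits m \<and> length ys = r \<and> set ys \<subseteq> bits n \<and> distinct ys"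
  have "card (set ys) < card (bits n)"
    using * assms(2) by (simp add: distinct_card)
  then obtain y where y: "y \<in> bits n" "y \<notin> set ys"
    by (metis card_mono finite_set not_less subsetI)
  let ?A = "\<lambda>b. {h. (\<forall>i<r. h (ys ! i) = as ! i) \<and> h y = b}"
  let ?P = "measure_pmf.prob (pmf_of_set Hs)"
  have "?P {h. \<forall>i<r. h (ys ! i) = as ! i} = ?P (\<Union>b\<in>bits m. ?A b)"
    using sub y by (intro measure_pmf.finite_measure_eq_AE AE_pmfI) (auto simp: fin ne)
  also have "\<dots> = (\<Sum>b\<in>bits m. ?P (?A b))"
    by (intro measure_pmf.finite_measure_finite_Union) (auto simp: disjoint_family_on_def)
  also have "\<dots> = (\<Sum>b\<in>bits m. 1 / 2 ^ (m * Suc r))"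
  proof (intro sum.cong refl)
    fix b assume b: "b \<in> bits m"
    have "?A b = {h. \<forall>i<Suc r. h ((ys @ [y]) ! i) = (as @ [b]) ! i}"
      using * by (auto simp: less_Suc_eq nth_append)
    also have "?P \<dots> = 1 / 2 ^ (m * Suc r)"
      using assms(1) * y b unfolding r_wise_independent_def
      by (elim conjE allE[of _ "as @ [b]"] allE[of _ "ys @ [y]"]) auto
    finally show "?P (?A b) = 1 / 2 ^ (m * Suc r)" .
  qed
  also have "\<dots> = 1 / 2 ^ (m * r)"
    by (simp add: power_add)
  finally show "?P {h. \<forall>i<r. h (ys ! i) = as ! i} = 1 / 2 ^ (m * r)" .
qed

lemma r_wise_independent_mono:
  assumes "s \<le> r" and "r_wise_independent n m r Hs" and "r \<le> 2 ^ n"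
  shows "r_wise_independent n m s Hs"
  using assms
  by (induction s rule: inc_induct) (auto intro: r_wise_independent_Suc)

lemma expectation_of_bool:
  "measure_pmf.expectation p (\<lambda>x. of_bool (P x) :: real) = measure_pmf.prob p {x. P x}"
proof -
  have "measure_pmf.expectation p (\<lambda>x. of_bool (P x) :: real)
      = measure_pmf.expectation p (indicator {x. P x})"
    by (intro Bochner_Integration.integral_cong) auto
  then show ?thesis by simp
qed

text \<open>The cell size is a sum of indicators, one for each element of \<open>R\<close>, so its
  first two moments involve at most two points at a time and pairwise independence determines
  them.\<close>

lemma cell_size_moments:
  fixes a :: "bool list"
  assumes H: "r_wise_independent n m r Hs" "2 \<le> r" "r \<le> 2 ^ n"
    and R: "R \<subseteq> bits n" and a: "a \<in> bits m"
  defines "N \<equiv> \<lambda>h. real (card {y \<in> R. h y = a})" and "\<mu> \<equiv> card R / 2 ^ m"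
  shows "measure_pmf.expectation (pmf_of_set Hs) N = \<mu>"
    and "measure_pmf.expectation (pmf_of_set Hs) (\<lambda>h. N h ^ 2) \<le> \<mu>\<^sup>2 + \<mu>"
proof -
  let ?E = "measure_pmf.expectation (pmf_of_set Hs)"
  let ?P = "measure_pmf.prob (pmf_of_set Hs)"
  have fin: "finite (set_pmf (pmf_of_set Hs))"
    using H(1) by (simp add: r_wise_independent_def)
  note [simp] = integrable_measure_pmf_finite[OF fin]
  have finR: "finite R"
    using finite_subset[OF R] by simp
  have N: "N h = (\<Sum>y\<in>R. of_bool (h y = a))" for h
    using finR by (simp add: N_def sum.If_cases of_bool_def Int_def)
  have P1: "?P {h. h y = a} = 1 / 2 ^ m" if "y \<in> R" for y
  proof -
    have "r_wise_independent n m 1 Hs"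
      using H by (intro r_wise_independent_mono[of 1 r]) auto
    then have "?P {h. \<forall>i<1. h ([y] ! i) = [a] ! i} = 1 / 2 ^ (m * 1)"
      unfolding r_wise_independent_def using that R a
      by (elim conjE allE[of _ "[a]"] allE[of _ "[y]"]) auto
    then show ?thesis by simp
  qed
  have P2: "?P {h. h y = a \<and> h z = a} = 1 / 2 ^ (m * 2)" if "y \<in> R" "z \<in> R" "y \<noteq> z" for y z
  proof -
    have "r_wise_independent n m 2 Hs"
      using H by (intro r_wise_independent_mono[of 2 r])
    then have "?P {h. \<forall>i<2. h ([y, z] ! i) = [a, a] ! i} = 1 / 2 ^ (m * 2)"
      unfolding r_wise_independent_def using that R a
      by (elim conjE allE[of _ "[a, a]"] allE[of _ "[y, z]"]) auto
    then show ?thesis by (simp add: numeral_2_eq_2 All_less_Suc conj_commute)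
  qed
  show "?E N = \<mu>"
    unfolding N by (simp add: expectation_of_bool P1 \<mu>_def)
  have "N h ^ 2 = (\<Sum>y\<in>R. \<Sum>z\<in>R. of_bool (h y = a \<and> h z = a))" for h
    unfolding N power2_eq_square sum_product by (intro sum.cong refl) auto
  then have "?E (\<lambda>h. N h ^ 2) = (\<Sum>y\<in>R. \<Sum>z\<in>R. ?P {h. h y = a \<and> h z = a})"
    by (simp add: expectation_of_bool del: of_bool_conj)
  \<comment> \<open>Adding \<open>1 / 2 ^ (m * 2)\<close> on the diagonal as well makes the second
    summands total exactly \<open>\<mu>\<^sup>2\<close>; the first ones total
    \<open>\<mu>\<close>.\<close>
  also have "\<dots> \<le> (\<Sum>y\<in>R. \<Sum>z\<in>R. (if y = z then 1 / 2 ^ m else 0) + 1 / 2 ^ (m * 2))"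
    by (intro sum_mono) (auto simp: P1 P2)
  also have "\<dots> = \<mu>\<^sup>2 + \<mu>"
    using finR by (simp add: sum.distrib \<mu>_def power_mult power2_eq_square power_mult_distrib algebra_simps)
  finally show "?E (\<lambda>h. N h ^ 2) \<le> \<mu>\<^sup>2 + \<mu>" .
qed

section \<open>Lower bounds on expectations from two moments\<close>

text \<open>The truncated ratio has the quadratic minorant
  \<open>s / t - s * (s - 1) / t\<^sup>2\<close>, whose expectation the two moments control.
  Integrality enters twice: \<open>s * (s - 1)\<close> is never negative, and \<open>s > t\<close>
  gives \<open>s - 1 \<ge> t\<close>, so the minorant is at most 0 there.\<close>

lemma expectation_truncated_ge:
  fixes N :: "'a \<Rightarrow> nat" and t :: nat
  assumes fin: "finite (set_pmf p)"
    and E1: "measure_pmf.expectation p (\<lambda>x. real (N x)) = \<mu>"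
    and E2: "measure_pmf.expectation p (\<lambda>x. real (N x) ^ 2) \<le> \<mu>\<^sup>2 + \<mu>"
    and t: "t > 0"
  shows "\<mu> / t - (\<mu> / t)\<^sup>2 \<le> measure_pmf.expectation p (\<lambda>x. if N x \<le> t then N x / t else 0)"
proof -
  note [simp] = integrable_measure_pmf_finite[OF fin]
  have pw: "real s / t - (real s ^ 2 - real s) / t\<^sup>2 \<le> (if s \<le> t then s / t else 0)" for s :: nat
  proof (cases "s \<le> t")
    case True
    have "real s \<le> real s ^ 2"
      by (cases s) (auto simp: power2_eq_square)
    then show ?thesis using True by simp
  next
    case False
    then have "real s * t \<le> real s * (real s - 1)"
      by (intro mult_left_mono) auto
    then show ?thesis using False t
      by (simp add: field_simps power2_eq_square)
  qed
  have "\<mu> / t - (\<mu> / t)\<^sup>2 = \<mu> / t - (\<mu>\<^sup>2 + \<mu> - \<mu>) / t\<^sup>2"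
    by (simp add: power_divide)
  also have "\<dots> \<le> \<mu> / t - (measure_pmf.expectation p (\<lambda>x. real (N x) ^ 2) - \<mu>) / t\<^sup>2"
    using E2 by (intro diff_left_mono divide_right_mono) auto
  also have "\<dots> = measure_pmf.expectation p (\<lambda>x. real (N x) / t - (real (N x) ^ 2 - real (N x)) / t\<^sup>2)"
    using E1 by simp
  also have "\<dots> \<le> measure_pmf.expectation p (\<lambda>x. if N x \<le> t then N x / t else 0)"
    by (intro integral_mono pw) auto
  finally show ?thesis .
qed

text \<open>Chebyshev's inequality in integrated form:
  \<open>c * (1 - (N x - \<mu>)\<^sup>2 / (\<mu> - \<tau>)\<^sup>2)\<close> never exceeds
  \<open>c\<close> and is at most 0 where \<open>N x < \<tau>\<close>, hence lies below
  \<open>f\<close>; the moments bound the variance by \<open>\<mu>\<close>.\<close>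

lemma expectation_ge_of_lower_tail:
  fixes N f :: "'a \<Rightarrow> real"
  assumes fin: "finite (set_pmf p)"
    and E1: "measure_pmf.expectation p N = \<mu>"
    and E2: "measure_pmf.expectation p (\<lambda>x. N x ^ 2) \<le> \<mu>\<^sup>2 + \<mu>"
    and \<tau>: "\<tau> < \<mu>" and c: "0 \<le> c"
    and f: "\<And>x. 0 \<le> f x" "\<And>x. N x \<ge> \<tau> \<Longrightarrow> c \<le> f x"
  shows "c * (1 - \<mu> / (\<mu> - \<tau>)\<^sup>2) \<le> measure_pmf.expectation p f"
proof -
  note [simp] = integrable_measure_pmf_finite[OF fin]
  have pw: "c * (1 - (N x - \<mu>)\<^sup>2 / (\<mu> - \<tau>)\<^sup>2) \<le> f x" for x
  proof (cases "N x \<ge> \<tau>")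
    case True
    have "c * (1 - (N x - \<mu>)\<^sup>2 / (\<mu> - \<tau>)\<^sup>2) \<le> c * 1"
      using c by (intro mult_left_mono) auto
    then show ?thesis using f(2)[OF True] by simp
  next
    case False
    then have "(\<mu> - \<tau>)\<^sup>2 \<le> (\<mu> - N x)\<^sup>2"
      using \<tau> by (intro power_mono) auto
    then have "1 - (N x - \<mu>)\<^sup>2 / (\<mu> - \<tau>)\<^sup>2 \<le> 0"
      using \<tau> by (simp add: field_simps power2_commute)
    then show ?thesis using c f(1)[of x] by (meson mult_nonneg_nonpos order_trans)
  qed
  have "measure_pmf.expectation p (\<lambda>x. (N x - \<mu>)\<^sup>2)
      = measure_pmf.expectation p (\<lambda>x. N x ^ 2 - 2 * \<mu> * N x + \<mu>\<^sup>2)"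
    by (intro Bochner_Integration.integral_cong) (auto simp: power2_eq_square algebra_simps)
  also have "\<dots> \<le> \<mu>"
    using E1 E2 by (simp add: power2_eq_square)
  finally have "c * (1 - \<mu> / (\<mu> - \<tau>)\<^sup>2)
      \<le> c * (1 - measure_pmf.expectation p (\<lambda>x. (N x - \<mu>)\<^sup>2) / (\<mu> - \<tau>)\<^sup>2)"
    using c by (intro mult_left_mono diff_left_mono divide_right_mono) auto
  also have "\<dots> = measure_pmf.expectation p (\<lambda>x. c * (1 - (N x - \<mu>)\<^sup>2 / (\<mu> - \<tau>)\<^sup>2))"
    by simp
  also have "\<dots> \<le> measure_pmf.expectation p f"
    by (intro integral_mono pw) auto
  finally show ?thesis .
qed

section \<open>The final choice and a single iteration\<close>

text \<open>The part of \<open>UniWit\<close> after the loop, split off so that loop and final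
  choice together can be analysed by recursion on the iteration.\<close>

definition select :: "nat \<Rightarrow> bool list set \<Rightarrow> bool list option pmf" where
  "select piv S =
     (if card S > piv \<or> card S < 1 then return_pmf None
      else do {
        j \<leftarrow> pmf_of_set {1..piv};
        return_pmf (if j \<le> card S then Some (list_of S ! (j - 1)) else None)
      })"

lemma prob_select:
  "measure_pmf.prob (select piv S) {out. out \<noteq> None}
     = (if 1 \<le> card S \<and> card S \<le> piv then card S / piv else 0)"
proof (cases "1 \<le> card S \<and> card S \<le> piv")
  case True
  have "{1..piv} \<inter> {j. j \<le> card S} = {1..card S}"
    using True by auto
  moreover have "(\<lambda>j. if j \<le> card S then Some (list_of S ! (j - 1)) else None) -` {out. out \<noteq> None}
      = {j. j \<le> card S}"
    by auto
  moreover have "select piv S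
      = map_pmf (\<lambda>j. if j \<le> card S then Some (list_of S ! (j - 1)) else None) (pmf_of_set {1..piv})"
    using True by (auto simp: select_def map_pmf_def)
  ultimately show ?thesis
    using True by (simp add: measure_pmf_of_set)
next
  case False
  then show ?thesis by (auto simp: select_def)
qed

text \<open>
  The expectation is conditional on the value of \<open>\<alpha>\<close>: the moments of a cell size
  do not depend on \<open>\<alpha>\<close>, so its randomness is never needed.
\<close>

lemma UniWit_loop_step:
  fixes H :: "nat \<Rightarrow> nat \<Rightarrow> nat \<Rightarrow> (bool list \<Rightarrow> bool list) set"
    and F :: cnf and n r piv l i :: nat and c :: real
  assumes bsat: "is_BoundedSAT n bsat"
  defines "W \<equiv> \<lambda>i. measure_pmf.prob (UniWit_loop H bsat r n F piv l i \<bind> select piv) {out. out \<noteq> None}"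
    and "N \<equiv> \<lambda>a h. card {y \<in> witnesses n (CNF F). h y = a}"
  assumes c: "\<And>a. a \<in> bits (i - l) \<Longrightarrow>
      c \<le> measure_pmf.expectation (pmf_of_set (H n (i - l) r))
            (\<lambda>h. if 1 \<le> N a h \<and> N a h \<le> piv then N a h / piv
                 else if n \<le> i then 0 else W (i + 1))"
  shows "c \<le> W i"
proof -
  let ?S = "\<lambda>h a. bsat (Conj (CNF F) (Constraint (\<lambda>z. h z = a))) (piv + 1)"
  let ?K = "\<lambda>h a. if (1 \<le> card (?S h a) \<and> card (?S h a) \<le> piv) \<or> i \<ge> n
       then return_pmf (?S h a) else UniWit_loop H bsat r n F piv l (i + 1)"
  have S: "card (?S h a) = min (piv + 1) (N a h)" for h a
  proof -
    have "witnesses n (Conj (CNF F) (Constraint (\<lambda>z. h z = a))) = {y \<in> witnesses n (CNF F). h y = a}"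
      by (auto simp: witnesses_def)
    then show ?thesis using bsat by (simp add: is_BoundedSAT_def N_def)
  qed
  \<comment> \<open>Truncation of the cell size at \<open>piv + 1\<close> changes neither the exit
    test nor the size of an accepted cell.\<close>
  have K: "measure_pmf.prob (?K h a \<bind> select piv) {out. out \<noteq> None} =
      (if 1 \<le> N a h \<and> N a h \<le> piv then N a h / piv else if n \<le> i then 0 else W (i + 1))" for h a
    by (simp add: bind_return_pmf prob_select S[simplified] W_def min_le_iff_disj del: not_None_eq)
  have "UniWit_loop H bsat r n F piv l i \<bind> select piv
      = pmf_of_set (H n (i - l) r) \<bind> (\<lambda>h. pmf_of_set (bits (i - l)) \<bind> (\<lambda>a. ?K h a \<bind> select piv))"
    by (subst UniWit_loop.simps) (simp only: Let_def bind_assoc_pmf)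
  also have "\<dots> = pmf_of_set (bits (i - l)) \<bind> (\<lambda>a. pmf_of_set (H n (i - l) r) \<bind> (\<lambda>h. ?K h a \<bind> select piv))"
    by (rule bind_commute_pmf)
  finally have "W i = measure_pmf.prob \<dots> {out. out \<noteq> None}"
    by (simp only: W_def)
  also have "\<dots> \<ge> c"
  proof (rule prob_bind_pmf_ge)
    fix a assume "a \<in> set_pmf (pmf_of_set (bits (i - l)))"
    then have "a \<in> bits (i - l)" by simp
    then show "c \<le> measure_pmf.prob (pmf_of_set (H n (i - l) r) \<bind> (\<lambda>h. ?K h a \<bind> select piv)) {out. out \<noteq> None}"
      unfolding prob_bind_pmf[of "pmf_of_set (H n (i - l) r)"] K by (rule c)
  qed
  finally show ?thesis .
qed

section \<open>Success probability of the loop\<close>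

lemma UniWit_loop_success:
  fixes q :: real and piv d l n r :: nat
  assumes bsat: "is_BoundedSAT n bsat"
    and H: "\<And>m. m \<le> n \<Longrightarrow> r_wise_independent n m r (H n m r)" "2 \<le> r" "r \<le> 2 ^ n"
    and q: "q \<ge> 2" and R: "real (card (witnesses n (CNF F))) = 2 ^ d * q"
    and piv: "2 * q \<le> piv" "piv \<le> 2 * q + 1" and dn: "l + d \<le> n"
  shows "1 / 8 \<le> measure_pmf.prob (UniWit_loop H bsat r n F piv l l \<bind> select piv) {out. out \<noteq> None}"
proof -
  define R where "R = witnesses n (CNF F)"
  \<comment> \<open>\<open>W i\<close> is the success probability from iteration \<open>i\<close>
    on, and \<open>f m a h\<close> is its value in iteration \<open>l + m\<close> once
    \<open>h\<close> and \<open>a\<close> have been drawn.\<close>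
  define W where "W i = measure_pmf.prob (UniWit_loop H bsat r n F piv l i \<bind> select piv) {out. out \<noteq> None}" for i
  define N where "N a h = card {y \<in> R. h y = a}" for a :: "bool list" and h :: "bool list \<Rightarrow> bool list"
  define f where "f m a h = (if 1 \<le> N a h \<and> N a h \<le> piv then N a h / piv
      else if n \<le> l + m then 0 else W (l + m + 1))" for m a h
  define E where "E m g = measure_pmf.expectation (pmf_of_set (H n m r)) g" for m and g :: "_ \<Rightarrow> real"
  have piv0: "real piv > 0" using q piv by simp
  have W0: "W i \<ge> 0" for i by (simp add: W_def)
  have f0: "f m a h \<ge> 0" for m a h by (simp add: f_def W0)
  have step: "c \<le> W (l + m)" if "\<And>a. a \<in> bits m \<Longrightarrow> c \<le> E m (f m a)" for c m
    using that UniWit_loop_step[OF bsat, where i = "l + m" and l = l and piv = piv and c = c and F = F and H = H and r = r]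
    unfolding W_def f_def N_def R_def E_def by simp
  have finH: "finite (set_pmf (pmf_of_set (H n m r)))" if "m \<le> n" for m
    using H(1)[OF that] by (simp add: r_wise_independent_def)
  have mom: "E m (\<lambda>h. real (N a h)) = 2 ^ d * q / 2 ^ m"
            "E m (\<lambda>h. real (N a h) ^ 2) \<le> (2 ^ d * q / 2 ^ m)\<^sup>2 + 2 ^ d * q / 2 ^ m"
    if "m \<le> n" "a \<in> bits m" for m a
    using cell_size_moments[OF H(1)[OF that(1)] H(2,3), of R a] that(2) R
    by (auto simp: R_def witnesses_def N_def E_def)
  have top: "6 / 25 \<le> W (l + d)"
  proof (rule step)
    fix a assume a: "a \<in> bits d"
    have d: "d \<le> n" using dn by simp
    define x where "x = q / piv"
    \<comment> \<open>The lower bound comes from \<open>piv \<le> 2 * q + 1 \<le> 5 / 2 * q\<close>.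
      The product below equals \<open>x - x\<^sup>2 - 6 / 25\<close>.\<close>
    have x: "2 / 5 \<le> x" "x \<le> 1 / 2"
      using piv q piv0 by (auto simp: x_def field_simps)
    then have "0 \<le> (x - 2 / 5) * (3 / 5 - x)"
      by (intro mult_nonneg_nonneg) auto
    then have "6 / 25 \<le> x - x\<^sup>2"
      by (simp add: algebra_simps power2_eq_square)
    also have "\<dots> \<le> E d (\<lambda>h. if N a h \<le> piv then N a h / piv else 0)"
      using expectation_truncated_ge[OF finH[OF d], of "N a" q piv] mom[OF d a] piv0
      by (simp add: E_def x_def)
    \<comment> \<open>Whatever iterations after \<open>l + d\<close> contribute is bounded below by
      0.\<close>
    also have "\<dots> \<le> E d (f d a)"
      unfolding E_def
      by (intro integral_mono integrable_measure_pmf_finite finH d) (auto simp: f_def W0 not_le)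
    finally show "6 / 25 \<le> E d (f d a)" .
  qed
  show ?thesis
  proof (cases "piv \<le> 8")
    case True
    \<comment> \<open>Backward induction: \<open>j\<close> counts the iterations before
      \<open>l + d\<close>.\<close>
    have "j \<le> d \<Longrightarrow> 1 / 8 \<le> W (l + (d - j))" for j
    proof (induction j)
      case 0
      then show ?case using top by simp
    next
      case (Suc j)
      define m where "m = d - Suc j"
      have m: "m < d" "l + (d - j) = l + m + 1" "m \<le> n"
        using Suc.prems dn by (auto simp: m_def)
      \<comment> \<open>Either a nonempty cell is accepted and the choice of \<open>j\<close>
        succeeds with probability at least \<open>1 / piv\<close>, or the loop goes on, since
        \<open>m < d\<close> excludes the exit at \<open>n\<close>, and the induction hypothesis
        applies.\<close>
      have "1 / 8 \<le> f m a h" for a h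
      proof -
        have "1 / 8 \<le> real (N a h) / piv" if "1 \<le> N a h"
        proof -
          have "1 / 8 \<le> 1 / real piv" using True piv0 by (intro divide_left_mono) auto
          also have "\<dots> \<le> real (N a h) / piv" using that by (intro divide_right_mono) auto
          finally show ?thesis .
        qed
        then show ?thesis using Suc m dn by (auto simp: f_def)
      qed
      then have "1 / 8 \<le> W (l + m)"
        unfolding E_def by (intro step, unfold E_def)
          (intro measure_pmf.integral_ge_const integrable_measure_pmf_finite finH m AE_pmfI)
      then show ?case by (simp add: m_def)
    qed
    from this[of d] show ?thesis by (simp add: W_def)
  next
    case False
    then have q4: "q \<ge> 4" using piv by linarith
    \<comment> \<open>The loss at distance \<open>i\<close> before \<open>l + d\<close> is
      \<open>47 / 100 * 2^-i\<close>; summed over \<open>i = 1, ..., j\<close> this geometric series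
      gives the factor \<open>1 - 1 / 2 ^ j\<close>.\<close>
    have "j \<le> d \<Longrightarrow> 6 / 25 * (1 - 47 / 100 * (1 - 1 / 2 ^ j)) \<le> W (l + (d - j))" for j
    proof (induction j)
      case 0
      then show ?case using top by simp
    next
      case (Suc j)
      define m where "m = d - Suc j"
      have m: "m < d" "l + (d - j) = l + m + 1" "m \<le> n"
        using Suc.prems dn by (auto simp: m_def)
      define u :: real where "u = 1 / 2 ^ Suc j"
      define \<mu> where "\<mu> = q / u"
      \<comment> \<open>As \<open>q \<ge> 4\<close>,
        \<open>piv \<le> 2 * q + 1 \<le> 9 / 4 * q\<close>, and
        \<open>27 / 50 = 6 / 25 * 9 / 4\<close> makes a cell of size \<tau> succeed with probability
        at least \<open>6 / 25\<close>.\<close>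
      define \<tau> where "\<tau> = 27 / 50 * q"
      \<comment> \<open>The bound of the induction hypothesis, with
        \<open>1 / 2 ^ j = 2 * u\<close>.\<close>
      define c where "c = 6 / 25 * (1 - 47 / 100 * (1 - 2 * u))"
      have u: "0 < u" "u \<le> 1 / 2"
        by (auto simp: u_def field_simps)
      have c: "0 \<le> c" "c \<le> 6 / 25"
        using u by (auto simp: c_def)
      have cW: "c \<le> W (l + m + 1)"
        using Suc m by (simp add: c_def u_def)
      have "(2::real) ^ d = 2 ^ m * 2 ^ Suc j"
        using Suc.prems unfolding m_def power_add[symmetric] by simp
      then have \<mu>: "2 ^ d * q / 2 ^ m = \<mu>"
        by (simp add: \<mu>_def u_def)
      \<comment> \<open>From \<open>u \<le> 1 / 2\<close> follows
        \<open>\<tau> \<le> 27 / 100 * (q / u)\<close>.\<close>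
      have gap: "73 / 100 * (q / u) \<le> \<mu> - \<tau>"
        using u q4 by (simp add: \<mu>_def \<tau>_def field_simps)
      have pos: "0 < 73 / 100 * (q / u)"
        using u q4 by simp
      have pos': "\<tau> < \<mu>" and \<mu>0: "0 \<le> \<mu>"
        using gap pos by (linarith, simp add: \<mu>_def)
      have "\<mu> / (\<mu> - \<tau>)\<^sup>2 \<le> \<mu> / (73 / 100 * (q / u))\<^sup>2"
        using gap less_imp_le[OF pos] \<mu>0 zero_less_power[OF pos, of 2] pos'
        by (intro divide_left_mono power_mono mult_pos_pos) simp_all
      also have "\<dots> = u * (10000 / 5329) / q"
        using u q4 by (simp add: \<mu>_def field_simps power2_eq_square)
      also have "\<dots> \<le> u * (10000 / 5329) / 4"
        using u q4 by (intro divide_left_mono) auto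
      \<comment> \<open>Here \<open>10000 / 5329 = (100 / 73)\<^sup>2\<close>, and a quarter of it
        is about 0.4691.\<close>
      also have "\<dots> \<le> 47 / 100 * u"
        using u by simp
      finally have tail: "\<mu> / (\<mu> - \<tau>)\<^sup>2 \<le> 47 / 100 * u" .
      have "c * (1 - 47 / 100 * u) \<le> W (l + m)"
      proof (rule step)
        fix a assume a: "a \<in> bits m"
        \<comment> \<open>A cell that is not too small is either accepted, with success probability
          at least \<open>6 / 25\<close>, or too large, and then the loop goes on with probability
          at least \<open>c\<close>.\<close>
        have fc: "c \<le> f m a h" if "real (N a h) \<ge> \<tau>" for h
        proof -
          have "6 / 25 \<le> \<tau> / piv"
            using piv piv0 q4 by (simp add: \<tau>_def field_simps)
          also have "\<dots> \<le> real (N a h) / piv"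
            using that by (intro divide_right_mono) auto
          finally have "c \<le> real (N a h) / piv" using c by linarith
          then show ?thesis using cW m dn by (auto simp: f_def)
        qed
        have "c * (1 - 47 / 100 * u) \<le> c * (1 - \<mu> / (\<mu> - \<tau>)\<^sup>2)"
          using tail c by (intro mult_left_mono) auto
        also have "\<dots> \<le> E m (f m a)"
          unfolding E_def
          by (rule expectation_ge_of_lower_tail[OF finH[OF m(3)], of "\<lambda>h. real (N a h)"])
             (use mom[OF m(3) a] \<mu> pos' c(1) f0 fc in \<open>auto simp: E_def\<close>)
        finally show "c * (1 - 47 / 100 * u) \<le> E m (f m a)" .
      qed
      \<comment> \<open>With \<open>p = 47 / 100\<close>,
        \<open>(1 - p * (1 - 2 * u)) * (1 - p * u)\<close> exceeds \<open>1 - p * (1 - u)\<close> by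
        \<open>p\<^sup>2 * u * (1 - 2 * u)\<close>, which is nonnegative as
        \<open>u \<le> 1 / 2\<close>.\<close>
      moreover have "6 / 25 * (1 - 47 / 100 * (1 - u)) \<le> c * (1 - 47 / 100 * u)"
        using mult_left_mono[OF u(2), of u] u(1) by (simp add: c_def field_simps)
      ultimately show ?case by (simp add: m_def u_def)
    qed
    from this[of d] have "6 / 25 * (1 - 47 / 100 * (1 - 1 / 2 ^ d)) \<le> W l" by simp
    \<comment> \<open>Even the limit for large \<open>d\<close> suffices:
      \<open>6 / 25 * 53 / 100 = 0.1272\<close>.\<close>
    moreover have "(1::real) / 8 \<le> 6 / 25 * (1 - 47 / 100 * (1 - 1 / 2 ^ d))"
      by (simp add: field_simps)
    ultimately have "1 / 8 \<le> W l" by (rule order_trans[rotated])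
    then show ?thesis by (simp add: W_def)
  qed
qed

section \<open>From the input parameters to the loop estimate\<close>

theorem theorem4:
  fixes k n r :: nat
    and F :: cnf
    and H :: "nat \<Rightarrow> nat \<Rightarrow> nat \<Rightarrow> (bool list \<Rightarrow> bool list) set"
    and bsat :: "formula \<Rightarrow> nat \<Rightarrow> bool list set"
  assumes "2 \<le> r" and "r \<le> 2 ^ n"
    and "\<And>m. m \<le> n \<Longrightarrow> r_wise_independent n m r (H n m r)"
    and "is_BoundedSAT n bsat"
    and "k \<ge> 1" and "n > 2 ^ k"
    and "cnf_vars F \<subseteq> {..<n}"
    and "witnesses n (CNF F) \<noteq> {}"
    and "log 2 (real (card (witnesses n (CNF F)))) - 1 / real k * log 2 (real n) \<in> \<int>"
  shows "measure_pmf.prob (UniWit H bsat r n F k) {out. out \<noteq> None} \<ge> 1 / 8"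
proof -
  define R where "R = witnesses n (CNF F)"
  define piv where "piv = pivot n k"
  define l where "l = start_index n k"
  have RS: "R \<subseteq> bits n" by (auto simp: R_def witnesses_def)
  then have "finite R" by (rule finite_subset) simp
  then have R0: "card R > 0" using assms(8) by (simp add: R_def card_gt_0_iff)
  have R2: "card R \<le> 2 ^ n" using card_mono[OF finite_bits RS] by simp
  have S: "card (bsat (CNF F) (piv + 1)) = min (piv + 1) (card R)"
    using assms(4) by (simp add: is_BoundedSAT_def R_def)
  have UniWit: "UniWit H bsat r n F k =
     (if card R \<le> piv then
        map_pmf (\<lambda>j. Some (list_of (bsat (CNF F) (piv + 1)) ! (j - 1)))
          (pmf_of_set {1..card (bsat (CNF F) (piv + 1))})
      else UniWit_loop H bsat r n F piv l l \<bind> select piv)"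
    using S by (auto simp: UniWit_def Let_def piv_def l_def select_def[abs_def] map_pmf_def)
  show ?thesis
  proof (cases "card R \<le> piv")
    case True
    \<comment> \<open>With few witnesses every outcome is a \<open>Some\<close>, so success is
      certain.\<close>
    then show ?thesis by (simp add: UniWit vimage_def)
  next
    case False
    define q where "q = real n powr (1 / real k)"
    have n0: "real n > 0" using assms(6) by (cases n) auto
    have lq: "log 2 q = 1 / real k * log 2 (real n)"
      using n0 by (simp add: q_def log_powr)
    have q0: "q > 0" using n0 by (simp add: q_def)
    have "log 2 (2 ^ k) \<le> log 2 (real n)"
      using assms(6) n0 by (subst log_le_cancel_iff) (auto simp flip: of_nat_le_iff)
    then have lq1: "1 \<le> log 2 q"
      using assms(5) by (simp add: lq log_nat_power field_simps)
    then have q2: "2 \<le> q"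
      using q0 by (simp add: le_log_iff)
    have piv_eq: "piv = nat \<lceil>2 * q\<rceil>" by (simp add: piv_def pivot_def q_def)
    have pivq: "2 * q \<le> piv" "piv \<le> 2 * q + 1"
      using q0 by (simp_all add: piv_eq)
    obtain z :: int where z: "log 2 (card R) - log 2 q = z"
      using assms(9) lq by (auto simp: R_def elim: Ints_cases)
    \<comment> \<open>Entering the loop means \<open>card R > piv \<ge> 2 * q\<close>, so the
      integer \<open>z\<close> is nonnegative and serves as the exponent \<open>d\<close>.\<close>
    have "log 2 q \<le> log 2 (card R)"
      using False pivq q0 R0 by (subst log_le_cancel_iff) auto
    then have "z \<ge> 0" using z by linarith
    then obtain d where d: "z = int d" using nonneg_int_cases by blast
    have "2 powr (log 2 (card R)) = 2 powr (d + log 2 q)"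
      using z d by (simp add: algebra_simps)
    then have Rq: "real (card R) = 2 ^ d * q"
      using R0 q0 by (simp add: powr_add powr_realpow)
    \<comment> \<open>Iteration \<open>l + d\<close> is within the range of the loop:
      \<open>card R \<le> 2 ^ n\<close> bounds \<open>d + log 2 q\<close> by \<open>n\<close>, and
      \<open>l\<close> is \<open>log 2 q\<close> rounded down.\<close>
    have "log 2 (card R) \<le> log 2 (2 ^ n)"
      using R0 R2 by (subst log_le_cancel_iff) (auto simp flip: of_nat_le_iff)
    then have "d + log 2 q \<le> n" using z d by (simp add: log_nat_power)
    moreover have "real l \<le> log 2 q"
      using lq1 by (simp only: l_def start_index_def flip: lq) (simp add: of_nat_nat)
    ultimately have "l + d \<le> n" by linarith
    then have "1 / 8 \<le> measure_pmf.prob (UniWit_loop H bsat r n F piv l l \<bind> select piv) {out. out \<noteq> None}"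
      using UniWit_loop_success[of n bsat r H q F d piv l] assms(1-4) q2 Rq pivq by (simp add: R_def)
    then show ?thesis using False by (simp add: UniWit)
  qed
qed

end
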